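(* Let $\mathbb W=P(\overline w)$ with $\overline w\in\mathcal G$, and let $\mathbb U\subseteq\mathbb R^{n_u}$ be convex. Let $$\mathcal F=\left\{(z,z^+)\in\mathbb R^l\times\mathbb R^l\ \middle|\ \begin{array}{l}\exists(\zeta,\xi,u)\in\mathbb R^l\times(\mathbb R^m)^{|\mathbb J|}\times\mathbb U^{|\mathbb J|}:\ \forall i\in\{1,\ldots,\nu\},\ \forall j\in\mathbb J,\\ \overline v\le\zeta_1,\quad z_2\le\zeta_2,\\ YA\Lambda_i\Omega_j\zeta+YBu_j+\overline w\le\xi_j,\\ G\xi_j\le0,\quad H\zeta\le0,\quad Z\xi_j\le z^+\end{array}\right\}.$$ Then, for all $z,z^+\in\mathbb R^l$, $$(z,z^+)\in\mathcal F\quad\Longrightarrow\quad\exists\mu\in\mathcal U,\ \ \mathfrak P(z^+)\supseteq F(\mathfrak P(z),\mu).$$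
   Context: All vector inequalities are componentwise. $\mathbb K_{\mathrm c}^n$ is the set of compact subsets of $\mathbb R^n$ (including $\varnothing$) with the Hausdorff distance ($\varnothing$ at infinite distance from nonempty sets). System: $x_{k+1}=Ax_k+Bu_k+w_k$, $\eta_k=Cx_k+v_k$, with given real matrices $A\in\mathbb R^{n\times n}$, $B\in\mathbb R^{n\times n_u}$, $C\in\mathbb R^{n_v\times n}$, $u_k\in\mathbb U$ (compact), $w_k\in\mathbb W$ (convex polytope), $v_k\in\mathbb V\subseteq\mathbb R^{n_v}$ (convex polytope). Define $\mathfrak V=\{X\in\mathbb K_{\mathrm c}^n\mid\exists\eta\in\mathbb R^{n_v}:\eta-CX\subseteq\mathbb V\}$. $\mathcal U$ is the set of all maps $\mu:\mathbb K_{\mathrm c}^n\to\mathbb U$. For a collection $\mathfrak X\subseteq\mathbb K_{\mathrm c}^n$ and $\mu\in\mathcal U$, $$F(\mathfrak X,\mu)=\{X^+\in\mathbb K_{\mathrm c}^n\mid\exists X\in\mathfrak X\sqcap\mathfrak V:\ X^+\subseteq AX+B\mu(X)+\mathbb W\},\qquad\mathfrak X\sqcap\mathfrak V=\{X\cap V\mid X\in\mathfrak X,V\in\mathfrak V\}.$$ Configuration-constrained polytopes: $Y\in\mathbb R^{m\times n}$, $G\in\mathbb R^{n_G\times m}$ and $\Lambda_1,\ldots,\Lambda_\nu\in\mathbb R^{n\times m}$ are given such that, with $P(y)=\{x\in\mathbb R^n\mid Yx\le y\}$ and $\mathcal G=\{y\in\mathbb R^m\mid Gy\le0\}$, one has $$P(y)=\mathrm{conv}(\Lambda_1y,\ldots,\Lambda_\nu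 y)\iff y\in\mathcal G.$$ Polytopic ensembles: given $Z\in\mathbb R^{l\times m}$, for $z\in\mathbb R^l$ let $$\mathbb P(z)=\{y\in\mathbb R^m\mid Gy\le0,\ Zy\le z\},\qquad\mathfrak P(z)=\{X\in\mathbb K_{\mathrm c}^n\mid\exists y\in\mathbb P(z):\ X\subseteq P(y)\},$$ the latter being a compact (possibly empty) collection. The matrix is partitioned as $Z=(Z_1^\top,Z_2^\top)^\top$ with $Z_1\in\mathbb R^{l_1\times m}$, $l_1\le l$, and correspondingly $z=(z_1,z_2)$, $\zeta=(\zeta_1,\zeta_2)$ with $z_1,\zeta_1\in\mathbb R^{l_1}$. The templates $Y,G,Z_1$ and a vector $\overline v\in\mathbb R^{l_1}$ are chosen such that $$\mathfrak V=\{X\in\mathbb K_{\mathrm c}^n\mid\exists y\in\mathcal G:\ X\subseteq P(y),\ Z_1y\le\overline v\},$$ and such that $\mathfrak P(z)\cap\mathfrak V=\mathfrak P(\zeta)$ for $\zeta_1=\min(z_1,\overline v)$ (componentwise) and $\zeta_2=z_2$; in particular, $\overline v\le\zeta_1$ and $z_2\le\zeta_2$ imply $\mathfrak P(z)\cap\mathfrak V\subseteq\mathfrak P(\zeta)$. Vertices of $\mathbb P$: $H\in\mathbb R^{n_H\times l}$ and $\Omega_1,\ldots,\Omega_{\overline\nu}\in\mathbb R^{m\times l}$ are given such that, with $\mathcal H=\{z\in\mathbb R^l\mid Hz\le0\}$, $$\mathbb P(\zeta)=\mathrm{conv}(\Omega_1\zeta,\ldots,\Omega_{\overline\nu}\zeta)\iff\zeta\in\mathcal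 H.$$ For a collection $\mathfrak X$ closed under intersection with sets in $\mathbb K_{\mathrm c}^n$, $\partial\mathfrak X$ denotes the set of its extreme sets, i.e. those $X\in\mathrm{cl}(\mathfrak X)$ such that $X\cap Y'\ne X$ for all $Y'\in\mathrm{cl}(\mathfrak X)\setminus\{X\}$. The index set $$\mathbb J=\{j\in\{1,\ldots,\overline\nu\}\mid P(\Omega_j\zeta)\in\partial[\mathfrak P(\zeta)]\}$$ does not depend on the choice of $\zeta\in\mathcal H$, and the indices are enumerated so that $\mathbb J=\{1,\ldots,|\mathbb J|\}$. *)

theory Defs
  imports "HOL-Analysis.Analysis"
begin

text \<open>
  Matrices in $R^{p \times q}$ have type \<open>real^'q^'p\<close>; \<open>\<le>\<close> on vectors is the
  componentwise order of the library.
\<close>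

definition Kc :: "(real^'n) set set" where
  "Kc = {X. compact X}"

definition hausdorff_distance :: "(real^'n) set \<Rightarrow> (real^'n) set \<Rightarrow> ereal" where
  "hausdorff_distance X Y =
     (if X = {} \<and> Y = {} then 0
      else if X = {} \<or> Y = {} then \<infinity>
      else max (SUP x\<in>X. ereal (infdist x Y)) (SUP y\<in>Y. ereal (infdist y X)))"

definition Kc_closure :: "(real^'n) set set \<Rightarrow> (real^'n) set set" where
  "Kc_closure \<XX> = {X\<in>Kc. \<forall>\<epsilon>>0. \<exists>Y\<in>\<XX>. hausdorff_distance X Y < ereal \<epsilon>}"

definition extreme_sets :: "(real^'n) set set \<Rightarrow> (real^'n) set set" where
  "extreme_sets \<XX> = {X \<in> Kc_closure \<XX>. \<forall>Y' \<in> Kc_closure \<XX> - {X}. X \<inter> Y' \<noteq> X}"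

definition meets :: "(real^'n) set set \<Rightarrow> (real^'n) set set \<Rightarrow> (real^'n) set set"
    (infixl "\<sqinter>\<^sub>c" 70) where
  "\<XX> \<sqinter>\<^sub>c \<VV> = {X \<inter> V | X V. X \<in> \<XX> \<and> V \<in> \<VV>}"

definition measurement_sets ::
    "real^'n^'nv \<Rightarrow> (real^'nv) set \<Rightarrow> (real^'n) set set" where
  "measurement_sets C V = {X\<in>Kc. \<exists>\<eta>. (\<lambda>x. \<eta> - C *v x) ` X \<subseteq> V}"

definition policies :: "(real^'nu) set \<Rightarrow> ((real^'n) set \<Rightarrow> real^'nu) set" where
  "policies U = {\<mu>. \<forall>X\<in>Kc. \<mu> X \<in> U}"

definition ensemble_step ::
    "real^'n^'n \<Rightarrow> real^'nu^'n \<Rightarrow> real^'n^'nv \<Rightarrow> (real^'nv) set \<Rightarrow> (real^'n) set \<Rightarrow>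
     (real^'n) set set \<Rightarrow> ((real^'n) set \<Rightarrow> real^'nu) \<Rightarrow> (real^'n) set set" where
  "ensemble_step A B C V W \<XX> \<mu> =
     {X'\<in>Kc. \<exists>X \<in> \<XX> \<sqinter>\<^sub>c measurement_sets C V.
        X' \<subseteq> {A *v x + B *v \<mu> X + w | x w. x \<in> X \<and> w \<in> W}}"

definition poly_P :: "real^'n^'m \<Rightarrow> real^'m \<Rightarrow> (real^'n) set" where
  "poly_P Y y = {x. Y *v x \<le> y}"

text \<open>\<open>matrix_cone G\<close> is the cone \<open>\<G>\<close>, and \<open>matrix_cone H\<close> is \<open>\<H>\<close>.\<close>

definition matrix_cone :: "real^'m^'g \<Rightarrow> (real^'m) set" where
  "matrix_cone G = {y. G *v y \<le> 0}"

definition params_P :: "real^'m^'g \<Rightarrow> real^'m^'l \<Rightarrow> real^'l \<Rightarrow> (real^'m) set" where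
  "params_P G Z z = {y. G *v y \<le> 0 \<and> Z *v y \<le> z}"

definition ensemble_P ::
    "real^'n^'m \<Rightarrow> real^'m^'g \<Rightarrow> real^'m^'l \<Rightarrow> real^'l \<Rightarrow> (real^'n) set set" where
  "ensemble_P Y G Z z = {X\<in>Kc. \<exists>y\<in>params_P G Z z. X \<subseteq> poly_P Y y}"

text \<open>
  The row partition $Z = (Z_1, Z_2)$ is encoded by the set \<open>L\<close> of the row indices of $Z_1$, so
  that either block may be empty; $Z_1 y \le v$ becomes \<open>block_le L (Z *v y) v\<close>. Of a
  vector belonging to the first block, such as \<open>vbar\<close>, only the entries with index in \<open>L\<close> matter.
\<close>

definition block_le :: "'l set \<Rightarrow> real^'l \<Rightarrow> real^'l \<Rightarrow> bool" where
  "block_le L a b \<longleftrightarrow> (\<forall>k\<in>L. a $ k \<le> b $ k)"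

definition block_min :: "'l set \<Rightarrow> real^'l \<Rightarrow> real^'l \<Rightarrow> real^'l" where
  "block_min L vbar z = (\<chi> k. if k \<in> L then min (z $ k) (vbar $ k) else z $ k)"

text \<open>
  The index set is kept dependent on a reference point \<open>\<zeta>\<close> of the cone \<open>\<H>\<close>. At degenerate
  points it can be larger than at points of the relative interior; at \<open>\<zeta> = 0\<close>, where all vertices
  coincide, it contains every index.
\<close>

definition extreme_index ::
    "real^'n^'m \<Rightarrow> real^'m^'g \<Rightarrow> real^'m^'l \<Rightarrow> (nat \<Rightarrow> real^'l^'m) \<Rightarrow> nat \<Rightarrow>
     real^'l \<Rightarrow> nat set" where
  "extreme_index Y G Z \<Omega> \<nu>' \<zeta> =
     {j\<in>{1..\<nu>'}. poly_P Y (\<Omega> j *v \<zeta>) \<in> extreme_sets (ensemble_P Y G Z \<zeta>)}"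

text \<open>
  Families indexed by \<open>J\<close> are functions on \<open>nat\<close> whose values outside \<open>J\<close> are irrelevant.
\<close>

definition feasible_pairs ::
    "real^'n^'n \<Rightarrow> real^'nu^'n \<Rightarrow> (real^'nu) set \<Rightarrow>
     real^'n^'m \<Rightarrow> real^'m^'g \<Rightarrow> (nat \<Rightarrow> real^'m^'n) \<Rightarrow> nat \<Rightarrow> real^'m \<Rightarrow>
     real^'m^'l \<Rightarrow> 'l set \<Rightarrow> real^'l \<Rightarrow>
     real^'l^'h \<Rightarrow> (nat \<Rightarrow> real^'l^'m) \<Rightarrow> nat set \<Rightarrow> ((real^'l) \<times> (real^'l)) set" where
  "feasible_pairs A B U Y G \<Lambda> \<nu> wbar Z L vbar H \<Omega> J =
     {(z, z'). \<exists>(\<zeta> :: real^'l) (\<xi> :: nat \<Rightarrow> real^'m) (u :: nat \<Rightarrow> real^'nu).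
        (\<forall>j\<in>J. u j \<in> U) \<and>
        block_le L vbar \<zeta> \<and> block_le (- L) z \<zeta> \<and> H *v \<zeta> \<le> 0 \<and>
        (\<forall>i\<in>{1..\<nu>}. \<forall>j\<in>J.
           (Y ** A ** \<Lambda> i ** \<Omega> j) *v \<zeta> + (Y ** B) *v u j + wbar \<le> \<xi> j \<and>
           G *v \<xi> j \<le> 0 \<and> Z *v \<xi> j \<le> z')}"

end

theory Submission
  imports Defs
begin

text \<open>
  The heart of the matter is that the vertices whose polytopes are extreme in the ensemble dominate
  all the others, with the index set read off at one reference point \<open>\<zeta>0\<close> and used at
  another point \<open>\<zeta>\<close>. For this, replace a parameter \<open>y\<close> by the vector of support values of
  \<open>poly_P Y y\<close> in the directions of the rows of \<open>Y\<close> (\<open>facet_support\<close>). This vector, and not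
  \<open>y\<close> itself, decides inclusion: on the cone \<open>\<G>\<close> a facet may be slack, so \<open>poly_P Y y \<subseteq> poly_P Y y'\<close>
  does not imply \<open>y \<le> y'\<close>. Because the vertices are the linear images \<open>\<Lambda> i *v y\<close>, the
  support vector is sublinear everywhere and additive on \<open>\<G>\<close>. Extreme polytopes are thus
  Pareto maximal points of an essentially linear objective over the polytope of parameters.

  Fix a positive weight \<open>c\<close> and choose a vertex index \<open>j\<close> that maximizes the \<open>c\<close>-weighted
  support at \<open>\<zeta> + \<zeta>0\<close>. By additivity the maximum at \<open>\<zeta> + \<zeta>0\<close> splits into the maxima at
  \<open>\<zeta>\<close> and at \<open>\<zeta>0\<close>, so the same \<open>j\<close> is optimal at both points
  (\<open>common_maximal_vertex\<close>). Optimality at \<open>\<zeta>0\<close> makes its polytope extreme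
  (\<open>weight_maximal_imp_extreme\<close>), and optimality at \<open>\<zeta>\<close> says that no positive weight can
  separate a given parameter from the extreme indices. A separation argument
  (\<open>convex_combination_above_if_no_weight_separates\<close>) turns this into a single convex combination
  \<open>\<Sum>j. \<theta> j *\<^sub>R (\<Omega> j *v \<zeta>)\<close> over the extreme indices whose polytope contains the given one
  (\<open>extreme_vertices_dominate\<close>).

  The policy then interpolates the vertex controls: a set \<open>X\<close> that survives the measurement lies in
  the ensemble at \<open>\<zeta>\<close>, hence in such a convex combination, and it is assigned
  \<open>\<Sum>j. \<theta> j *\<^sub>R u j\<close>, which lies in \<open>U\<close> by convexity. The feasibility inequalities are jointly
  convex, so averaging them with the weights \<open>\<theta>\<close> shows that all successors of \<open>X\<close> lie in the
  polytope with parameter \<open>\<Sum>j. \<theta> j *\<^sub>R \<xi> j\<close>, which is admissible for \<open>z'\<close>.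
\<close>

section \<open>Pareto domination by convex combinations\<close>

lemma convex_hull_finite_imageE:
  assumes fin: "finite J" and x: "x \<in> convex hull (a ` J)"
  obtains \<theta> where "\<And>j. j \<in> J \<Longrightarrow> 0 \<le> \<theta> j" "sum \<theta> J = 1" "x = (\<Sum>j\<in>J. \<theta> j *\<^sub>R a j)"
proof -
  let ?S = "{\<Sum>j\<in>J. \<theta> j *\<^sub>R a j |\<theta>. (\<forall>j\<in>J. 0 \<le> \<theta> j) \<and> sum \<theta> J = (1::real)}"
  have "convex hull (a ` J) \<subseteq> ?S"
  proof (rule hull_minimal)
    show "a ` J \<subseteq> ?S"
    proof clarify
      fix j assume "j \<in> J"
      then show "\<exists>\<theta>. a j = (\<Sum>j\<in>J. \<theta> j *\<^sub>R a j) \<and> (\<forall>j\<in>J. 0 \<le> \<theta> j) \<and> sum \<theta> J = 1"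
        using fin by (intro exI[of _ "\<lambda>i. if i = j then 1 else 0"]) (simp add: if_distrib[of "\<lambda>r. r *\<^sub>R _"] cong: if_cong)
    qed
    show "convex ?S"
    proof (rule convexI; clarify)
      fix t t' :: real and \<theta> \<theta>' :: "_ \<Rightarrow> real"
      assume *: "0 \<le> t" "0 \<le> t'" "t + t' = 1" "\<forall>j\<in>J. 0 \<le> \<theta> j" "\<forall>j\<in>J. 0 \<le> \<theta>' j"
        "sum \<theta> J = 1" "sum \<theta>' J = 1"
      then show "\<exists>\<psi>. t *\<^sub>R (\<Sum>j\<in>J. \<theta> j *\<^sub>R a j) + t' *\<^sub>R (\<Sum>j\<in>J. \<theta>' j *\<^sub>R a j) = (\<Sum>j\<in>J. \<psi> j *\<^sub>R a j)
          \<and> (\<forall>j\<in>J. 0 \<le> \<psi> j) \<and> sum \<psi> J = 1"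
        by (intro exI[of _ "\<lambda>j. t * \<theta> j + t' * \<theta>' j"])
           (simp add: scaleR_left_distrib sum.distrib scaleR_right.sum sum_distrib_left[symmetric])
    qed
  qed
  with x that show thesis by blast
qed

lemma inner_mono_weight:
  fixes c :: "real^'m"
  assumes "\<forall>k. 0 < c $ k" "a \<le> b"
  shows "c \<bullet> a \<le> c \<bullet> b"
  using assms unfolding inner_vec_def
  by (intro sum_mono) (simp add: less_eq_vec_def mult_left_mono less_imp_le)

text \<open>
  If no convex combination of the \<open>a j\<close> lies above \<open>b\<close>, then their hull is disjoint from the
  orthant above \<open>b\<close>. A hyperplane separating the two is nonnegative, since the orthant is
  unbounded in the coordinate directions, and can be tilted to a positive weight.
\<close>

lemma convex_combination_above_if_no_weight_separates:
  fixes a :: "'i \<Rightarrow> real^'m" and b :: "real^'m"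
  assumes fin: "finite J"
    and weight: "\<And>c. (\<forall>k. 0 < c $ k) \<Longrightarrow> \<exists>j\<in>J. c \<bullet> b \<le> c \<bullet> a j"
  obtains \<theta> where "\<And>j. j \<in> J \<Longrightarrow> 0 \<le> \<theta> j" "sum \<theta> J = 1" "b \<le> (\<Sum>j\<in>J. \<theta> j *\<^sub>R a j)"
proof -
  define K where "K = convex hull (a ` J)"
  have "\<exists>j\<in>J. (1::real^'m) \<bullet> b \<le> 1 \<bullet> a j"
    by (rule weight) simp
  then have Kne: "K \<noteq> {}" unfolding K_def by auto
  have "K \<inter> {b..} \<noteq> {}"
  proof
    assume disj: "K \<inter> {b..} = {}"
    have "compact K" unfolding K_def
      using fin by (simp add: finite_imp_compact_convex_hull)
    moreover have "closed {b..}" "{b..} \<noteq> {}"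
      by auto
    moreover have "convex {b..}"
    proof (rule convexI; clarsimp)
      fix x y :: "real^'m" and t t' :: real
      assume *: "b \<le> x" "b \<le> y" "0 \<le> t" "0 \<le> t'" "t + t' = 1"
      have "b = t *\<^sub>R b + t' *\<^sub>R b"
        using * by (metis scaleR_left_distrib scaleR_one)
      also have "\<dots> \<le> t *\<^sub>R x + t' *\<^sub>R y"
        using * by (intro add_mono scaleR_left_mono)
      finally show "b \<le> t *\<^sub>R x + t' *\<^sub>R y" .
    qed
    moreover have "convex K" by (simp add: K_def)
    ultimately obtain c \<beta> where "\<forall>x\<in>K. c \<bullet> x < \<beta>" "\<forall>x\<in>{b..}. \<beta> < c \<bullet> x"
      using separating_hyperplane_compact_closed[of K "{b..}"] Kne disj by blast
    then have lo: "\<And>x. x \<in> K \<Longrightarrow> c \<bullet> x < \<beta>" and hi: "\<And>x. b \<le> x \<Longrightarrow> \<beta> < c \<bullet> x"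
      by auto
    have cnn: "0 \<le> c $ k" for k
    proof (rule ccontr)
      assume "\<not> 0 \<le> c $ k"
      then have neg: "c $ k < 0" by simp
      define t where "t = \<bar>\<beta> - c \<bullet> b\<bar> / (- c $ k)"
      have "0 \<le> t" unfolding t_def using neg by (intro divide_nonneg_nonneg) auto
      then have "b \<le> b + t *\<^sub>R axis k 1"
        by (auto simp: less_eq_vec_def axis_def)
      then have "\<beta> < c \<bullet> b + t * c $ k"
        using hi[of "b + t *\<^sub>R axis k 1"] by (simp add: inner_add_right inner_axis)
      moreover have "t * c $ k = - \<bar>\<beta> - c \<bullet> b\<bar>"
        using neg by (simp add: t_def)
      ultimately show False using hi[of b] by simp
    qed
    \<comment> \<open>A separating functional may have zero entries; adding a small multiple of the all-ones vector
      makes it positive and keeps the finitely many strict inequalities.\<close>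
    have "\<forall>\<^sub>F e in at_right (0::real). \<forall>j\<in>J. (c + e *\<^sub>R 1) \<bullet> a j < (c + e *\<^sub>R 1) \<bullet> b"
    proof (intro eventually_ball_finite[OF fin] ballI)
      fix j assume "j \<in> J"
      then have "c \<bullet> a j < c \<bullet> b"
        using lo[of "a j"] hi[of b] by (force simp: K_def hull_inc)
      moreover have "((\<lambda>e. (c + e *\<^sub>R 1) \<bullet> b - (c + e *\<^sub>R 1) \<bullet> a j)
          \<longlongrightarrow> (c + 0 *\<^sub>R 1) \<bullet> b - (c + 0 *\<^sub>R 1) \<bullet> a j) (at_right (0::real))"
        by (intro tendsto_intros)
      ultimately show "\<forall>\<^sub>F e in at_right (0::real). (c + e *\<^sub>R 1) \<bullet> a j < (c + e *\<^sub>R 1) \<bullet> b"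
        using order_tendstoD(1)[where a = 0] by (fastforce elim: eventually_mono)
    qed
    then obtain e where e: "0 < e" "\<forall>j\<in>J. (c + e *\<^sub>R 1) \<bullet> a j < (c + e *\<^sub>R 1) \<bullet> b"
      using eventually_happens'[OF trivial_limit_at_right_real
          eventually_conj[OF eventually_at_right_less[of 0]]] by blast
    have "\<exists>j\<in>J. (c + e *\<^sub>R 1) \<bullet> b \<le> (c + e *\<^sub>R 1) \<bullet> a j"
      using e(1) cnn by (intro weight) (simp add: add_nonneg_pos)
    with e(2) show False by force
  qed
  then obtain x where x: "b \<le> x" "x \<in> K" by auto
  then show thesis
    using that convex_hull_finite_imageE[OF fin] unfolding K_def by metis
qed

section \<open>Support vectors of configuration-constrained polytopes\<close>

text \<open>
  For \<open>y\<close> in the cone \<open>\<G>\<close> the entries are the values at the rows of \<open>Y\<close> of the support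
  function of \<open>poly_P Y y\<close>. The definition by the vertex maps keeps it sublinear also outside \<open>\<G>\<close>.
\<close>

definition facet_support :: "real^'n^'m \<Rightarrow> (nat \<Rightarrow> real^'m^'n) \<Rightarrow> nat \<Rightarrow> real^'m \<Rightarrow> real^'m" where
  "facet_support Y \<Lambda> \<nu> y = (\<chi> k. Max ((\<lambda>i. (Y *v (\<Lambda> i *v y)) $ k) ` {1..\<nu>}))"

lemma zero_in_matrix_cone: "0 \<in> matrix_cone G"
  by (simp add: matrix_cone_def)

text \<open>Both vertex counts are positive because the represented polytopes contain the origin at
  parameter zero. This is what makes the maxima over the vertices meaningful.\<close>

lemma vertex_count_pos:
  fixes \<nu> :: nat
  assumes "\<And>y. y \<in> matrix_cone G \<Longrightarrow> poly_P Y y = convex hull ((\<lambda>i. \<Lambda> i *v y) ` {1..\<nu>})"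
  shows "1 \<le> \<nu>"
proof (rule ccontr)
  assume "\<not> 1 \<le> \<nu>"
  then have "{1..\<nu>} = {}" by auto
  with assms[OF zero_in_matrix_cone] have "poly_P Y 0 = {}" by simp
  moreover have "0 \<in> poly_P Y 0" by (simp add: poly_P_def)
  ultimately show False by simp
qed

lemma params_vertex_count_pos:
  fixes \<nu>' :: nat
  assumes "\<And>\<zeta>. \<zeta> \<in> matrix_cone H \<Longrightarrow> params_P G Z \<zeta> = convex hull ((\<lambda>j. \<Omega> j *v \<zeta>) ` {1..\<nu>'})"
  shows "1 \<le> \<nu>'"
proof (rule ccontr)
  assume "\<not> 1 \<le> \<nu>'"
  then have "{1..\<nu>'} = {}" by auto
  with assms[OF zero_in_matrix_cone] have "params_P G Z 0 = {}" by simp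
  moreover have "0 \<in> params_P G Z 0" by (simp add: params_P_def)
  ultimately show False by simp
qed

lemma matrix_cone_add:
  assumes "y \<in> matrix_cone G" "y' \<in> matrix_cone G"
  shows "y + y' \<in> matrix_cone G"
  using assms by (simp add: matrix_cone_def matrix_vector_right_distrib add_nonpos_nonpos)

lemma params_P_add:
  assumes "y \<in> params_P G Z z" "y' \<in> params_P G Z z'"
  shows "y + y' \<in> params_P G Z (z + z')"
  using assms by (simp add: params_P_def matrix_vector_right_distrib add_nonpos_nonpos add_mono)

lemma convex_matrix_preimage_atMost:
  fixes M :: "real^'q^'p"
  shows "convex {x. M *v x \<le> b}"
proof -
  have "{x. M *v x \<le> b} = (\<Inter>k. {x. row k M \<bullet> x \<le> b $ k})"
    by (auto simp: less_eq_vec_def matrix_vector_mul_component row_def)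
  then show ?thesis by (auto intro: convex_INT convex_halfspace_le)
qed

context
  fixes Y :: "real^'n^'m" and G :: "real^'m^'g" and \<Lambda> :: "nat \<Rightarrow> real^'m^'n" and \<nu> :: nat
  assumes configuration:
    "\<And>y. y \<in> matrix_cone G \<Longrightarrow> poly_P Y y = convex hull ((\<lambda>i. \<Lambda> i *v y) ` {1..\<nu>})"
begin

private abbreviation "\<sigma> \<equiv> facet_support Y \<Lambda> \<nu>"

lemma facet_support_attained:
  obtains i where "i \<in> {1..\<nu>}" "\<sigma> y $ k = (Y *v (\<Lambda> i *v y)) $ k"
proof -
  have "Max ((\<lambda>i. (Y *v (\<Lambda> i *v y)) $ k) ` {1..\<nu>}) \<in> (\<lambda>i. (Y *v (\<Lambda> i *v y)) $ k) ` {1..\<nu>}"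
    using vertex_count_pos[OF configuration] by (intro Max_in) auto
  then show thesis using that by (auto simp: facet_support_def)
qed

lemma vertex_le_facet_support:
  "i \<in> {1..\<nu>} \<Longrightarrow> (Y *v (\<Lambda> i *v y)) $ k \<le> \<sigma> y $ k"
  by (simp add: facet_support_def)

lemma vertex_in_poly_P:
  "y \<in> matrix_cone G \<Longrightarrow> i \<in> {1..\<nu>} \<Longrightarrow> \<Lambda> i *v y \<in> poly_P Y y"
  by (simp add: configuration hull_inc)

lemma facet_support_le:
  assumes "y \<in> matrix_cone G"
  shows "\<sigma> y \<le> y"
  unfolding less_eq_vec_def
proof
  fix k
  obtain i where "i \<in> {1..\<nu>}" "\<sigma> y $ k = (Y *v (\<Lambda> i *v y)) $ k"
    by (rule facet_support_attained)
  with vertex_in_poly_P[OF assms] show "\<sigma> y $ k \<le> y $ k"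
    by (auto simp: poly_P_def less_eq_vec_def)
qed

lemma poly_P_le_facet_support:
  assumes "y \<in> matrix_cone G" "x \<in> poly_P Y y"
  shows "Y *v x \<le> \<sigma> y"
proof -
  have "convex hull ((\<lambda>i. \<Lambda> i *v y) ` {1..\<nu>}) \<subseteq> {x. Y *v x \<le> \<sigma> y}"
    using convex_matrix_preimage_atMost
    by (rule hull_minimal[rotated]) (auto simp: less_eq_vec_def intro: vertex_le_facet_support)
  with assms configuration show ?thesis by auto
qed

lemma facet_support_subadd: "\<sigma> (y + y') \<le> \<sigma> y + \<sigma> y'"
  unfolding less_eq_vec_def
proof
  fix k
  obtain i where "i \<in> {1..\<nu>}" "\<sigma> (y + y') $ k = (Y *v (\<Lambda> i *v (y + y'))) $ k"
    by (rule facet_support_attained)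
  with vertex_le_facet_support[of i y k] vertex_le_facet_support[of i y' k]
  show "\<sigma> (y + y') $ k \<le> (\<sigma> y + \<sigma> y') $ k"
    by (simp add: matrix_vector_right_distrib)
qed

lemma facet_support_scale:
  assumes "0 \<le> t"
  shows "\<sigma> (t *\<^sub>R y) \<le> t *\<^sub>R \<sigma> y"
  unfolding less_eq_vec_def
proof
  fix k
  obtain i where "i \<in> {1..\<nu>}" "\<sigma> (t *\<^sub>R y) $ k = (Y *v (\<Lambda> i *v (t *\<^sub>R y))) $ k"
    by (rule facet_support_attained)
  with vertex_le_facet_support[of i y k] assms
  show "\<sigma> (t *\<^sub>R y) $ k \<le> (t *\<^sub>R \<sigma> y) $ k"
    by (simp add: matrix_vector_mult_scaleR mult_left_mono)
qed

text \<open>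
  The converse of subadditivity needs the cone: there the sum of two maximizing vertices is a point of
  the polytope of the sum, whatever their indices are.
\<close>

lemma facet_support_superadd:
  assumes y: "y \<in> matrix_cone G" and y': "y' \<in> matrix_cone G"
  shows "\<sigma> y + \<sigma> y' \<le> \<sigma> (y + y')"
  unfolding less_eq_vec_def
proof
  fix k
  obtain i where i: "i \<in> {1..\<nu>}" "\<sigma> y $ k = (Y *v (\<Lambda> i *v y)) $ k"
    by (rule facet_support_attained)
  obtain i' where i': "i' \<in> {1..\<nu>}" "\<sigma> y' $ k = (Y *v (\<Lambda> i' *v y')) $ k"
    by (rule facet_support_attained)
  have "\<Lambda> i *v y + \<Lambda> i' *v y' \<in> poly_P Y (y + y')"
    using vertex_in_poly_P[OF y i(1)] vertex_in_poly_P[OF y' i'(1)]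
    by (simp add: poly_P_def matrix_vector_right_distrib add_mono)
  then have "Y *v (\<Lambda> i *v y + \<Lambda> i' *v y') \<le> \<sigma> (y + y')"
    by (rule poly_P_le_facet_support[OF matrix_cone_add[OF y y']])
  then show "(\<sigma> y + \<sigma> y') $ k \<le> \<sigma> (y + y') $ k"
    using i(2) i'(2) by (simp add: less_eq_vec_def matrix_vector_right_distrib)
qed

lemma convex_weighted_facet_support_atMost:
  assumes c: "\<forall>k. 0 < c $ k"
  shows "convex {y. c \<bullet> \<sigma> y \<le> M}"
proof (rule convexI; clarsimp)
  fix y y' and t t' :: real
  assume *: "c \<bullet> \<sigma> y \<le> M" "c \<bullet> \<sigma> y' \<le> M" "0 \<le> t" "0 \<le> t'" "t + t' = 1"
  have "\<sigma> (t *\<^sub>R y + t' *\<^sub>R y') \<le> t *\<^sub>R \<sigma> y + t' *\<^sub>R \<sigma> y'"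
    using facet_support_subadd add_mono[OF facet_support_scale facet_support_scale] * order_trans
    by blast
  then have "c \<bullet> \<sigma> (t *\<^sub>R y + t' *\<^sub>R y') \<le> t * (c \<bullet> \<sigma> y) + t' * (c \<bullet> \<sigma> y')"
    using inner_mono_weight[OF c] by (fastforce simp: inner_add_right)
  also have "\<dots> \<le> M"
    using * by (intro convex_bound_le) auto
  finally show "c \<bullet> \<sigma> (t *\<^sub>R y + t' *\<^sub>R y') \<le> M" .
qed

section \<open>Extreme sets of the ensemble\<close>

text \<open>
  Suppose \<open>X\<close> in the closure contains \<open>poly_P Y y\<close>. Up to an arbitrarily small slack, the support
  values of \<open>X\<close> are at most those of some member of the ensemble, whose weighted sum is at most that
  of \<open>y\<close>. As the support values of \<open>X\<close> are also at least those of \<open>y\<close> and all weights are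
  positive, they agree with those of \<open>y\<close> in every coordinate, and \<open>X\<close> cannot be larger.
\<close>

lemma weight_maximal_imp_extreme:
  assumes c: "\<forall>k. 0 < c $ k" and y: "y \<in> params_P G Z z"
    and max: "\<And>y'. y' \<in> params_P G Z z \<Longrightarrow> c \<bullet> \<sigma> y' \<le> c \<bullet> \<sigma> y"
  shows "poly_P Y y \<in> extreme_sets (ensemble_P Y G Z z)"
proof -
  have cone: "y' \<in> matrix_cone G" if "y' \<in> params_P G Z z" for y'
    using that by (simp add: params_P_def matrix_cone_def)
  have ne: "poly_P Y y \<noteq> {}"
    using vertex_in_poly_P[OF cone[OF y]] vertex_count_pos[OF configuration] by fastforce
  have compact: "compact (poly_P Y y)"
    using configuration[OF cone[OF y]] by (simp add: finite_imp_compact_convex_hull)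
  have "hausdorff_distance (poly_P Y y) (poly_P Y y) = 0"
    using ne by (auto simp: hausdorff_distance_def cong: SUP_cong)
  moreover have "poly_P Y y \<in> ensemble_P Y G Z z"
    using y compact by (auto simp: ensemble_P_def Kc_def)
  ultimately have closure: "poly_P Y y \<in> Kc_closure (ensemble_P Y G Z z)"
    using compact by (auto simp: Kc_closure_def Kc_def zero_ereal_def intro!: bexI[of _ "poly_P Y y"])
  have "X = poly_P Y y" if X: "X \<in> Kc_closure (ensemble_P Y G Z z)" and sub: "poly_P Y y \<subseteq> X" for X
  proof
    show "poly_P Y y \<subseteq> X" by (fact sub)
    show "X \<subseteq> poly_P Y y"
    proof
      fix x assume x: "x \<in> X"
      have "(Y *v x) $ k \<le> \<sigma> y $ k" for k
      proof (rule field_le_epsilon)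
        fix e :: real assume "0 < e"
        \<comment> \<open>Moving by \<open>d\<close> changes the weighted sum of the support values by at most \<open>r * d\<close>;
          dividing this by the weight of coordinate \<open>k\<close> must leave at most \<open>e\<close>.\<close>
        define r where "r = (\<Sum>k\<in>UNIV. c $ k * norm (row k Y))"
        have "0 \<le> r" unfolding r_def using c by (simp add: sum_nonneg less_imp_le)
        define d where "d = e * c $ k / (r + 1)"
        have "0 < d" using \<open>0 < e\<close> c \<open>0 \<le> r\<close> by (simp add: d_def)
        with X obtain X' where X': "X' \<in> ensemble_P Y G Z z"
          and dist: "hausdorff_distance X X' < ereal d"
          by (auto simp: Kc_closure_def)
        from X' obtain y' where y': "y' \<in> params_P G Z z" "X' \<subseteq> poly_P Y y'"
          by (auto simp: ensemble_P_def)
        have "X' \<noteq> {}" "X \<noteq> {}"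
          using dist x by (auto simp: hausdorff_distance_def split: if_splits)
        have near: "(Y *v v) $ k' \<le> \<sigma> y' $ k' + norm (row k' Y) * d" if v: "v \<in> X" for v k'
        proof -
          have "ereal (infdist v X') \<le> hausdorff_distance X X'"
            using \<open>X' \<noteq> {}\<close> \<open>X \<noteq> {}\<close> v
            by (auto simp: hausdorff_distance_def le_max_iff_disj intro: SUP_upper)
          then have "infdist v X' < d" using dist by (metis ereal_less_eq(3) less_ereal.simps(1) order_le_less_trans)
          then obtain p where p: "p \<in> X'" "dist v p < d"
            using cInf_lessD[of "dist v ` X'" d] \<open>X' \<noteq> {}\<close> by (auto simp: infdist_notempty)
          have "row k' Y \<bullet> (v - p) \<le> norm (row k' Y) * norm (v - p)"
            by (rule norm_cauchy_schwarz)
          also have "\<dots> \<le> norm (row k' Y) * d"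
            using p(2) by (intro mult_left_mono) (auto simp: dist_norm)
          finally have "(Y *v v) $ k' \<le> (Y *v p) $ k' + norm (row k' Y) * d"
            by (simp add: matrix_vector_mul_component row_def inner_diff_right)
          moreover have "(Y *v p) $ k' \<le> \<sigma> y' $ k'"
            using poly_P_le_facet_support[OF cone[OF y'(1)]] p(1) y'(2) by (auto simp: less_eq_vec_def)
          ultimately show ?thesis by simp
        qed
        define b where "b = (\<chi> k'. norm (row k' Y) * d)"
        have le: "\<sigma> y \<le> \<sigma> y' + b"
          unfolding less_eq_vec_def
        proof
          fix k'
          obtain i where i: "i \<in> {1..\<nu>}" "\<sigma> y $ k' = (Y *v (\<Lambda> i *v y)) $ k'"
            by (rule facet_support_attained)
          then show "\<sigma> y $ k' \<le> (\<sigma> y' + b) $ k'"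
            using near[of "\<Lambda> i *v y" k'] vertex_in_poly_P[OF cone[OF y] i(1)] sub
            by (auto simp: b_def)
        qed
        have cb: "c \<bullet> b = r * d"
          by (simp add: b_def r_def inner_vec_def sum_distrib_right mult.assoc)
        \<comment> \<open>The vector \<open>\<sigma> y' + b - \<sigma> y\<close> is nonnegative, so its weighted sum bounds each entry.\<close>
        have "c $ k * ((\<sigma> y' + b) $ k - \<sigma> y $ k) = c $ k * (\<sigma> y' + b - \<sigma> y) $ k"
          by simp
        also have "\<dots> \<le> (\<Sum>k\<in>UNIV. c $ k * (\<sigma> y' + b - \<sigma> y) $ k)"
          using le c by (intro member_le_sum mult_nonneg_nonneg) (auto simp: less_eq_vec_def less_imp_le)
        also have "\<dots> = c \<bullet> (\<sigma> y' + b - \<sigma> y)"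
          by (simp add: inner_vec_def)
        also have "\<dots> \<le> r * d"
          using max[OF y'(1)] cb by (simp add: inner_diff_right inner_add_right)
        also have "\<dots> \<le> e * c $ k"
          using \<open>0 < e\<close> \<open>0 \<le> r\<close> c by (simp add: d_def field_simps less_imp_le)
        finally have "(\<sigma> y' + b) $ k - \<sigma> y $ k \<le> e"
          using c by (simp add: mult.commute)
        then show "(Y *v x) $ k \<le> \<sigma> y $ k + e"
          using near[OF x, of k] by (simp add: b_def)
      qed
      then have "Y *v x \<le> y"
        using facet_support_le[OF cone[OF y]] by (meson less_eq_vec_def order_trans)
      then show "x \<in> poly_P Y y" by (simp add: poly_P_def)
    qed
  qed
  with closure show ?thesis
    unfolding extreme_sets_def by blast
qed

context
  fixes Z :: "real^'m^'l" and H :: "real^'l^'h" and \<Omega> :: "nat \<Rightarrow> real^'l^'m" and \<nu>' :: nat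
  assumes params_vertices:
    "\<And>\<zeta>. \<zeta> \<in> matrix_cone H \<Longrightarrow> params_P G Z \<zeta> = convex hull ((\<lambda>j. \<Omega> j *v \<zeta>) ` {1..\<nu>'})"
begin

text \<open>
  The sum of the polytopes \<open>params_P G Z \<zeta>\<close> and \<open>params_P G Z \<zeta>0\<close> lies in the hull of the
  vertices at \<open>\<zeta> + \<zeta>0\<close>, where the convex weighted support is maximal at some vertex \<open>j\<close>. A
  pair of points maximizes a sum exactly if each maximizes its own summand, so \<open>j\<close> is optimal
  at both parameters.
\<close>

lemma common_maximal_vertex:
  assumes \<zeta>: "\<zeta> \<in> matrix_cone H" and \<zeta>0: "\<zeta>0 \<in> matrix_cone H" and c: "\<forall>k. 0 < c $ k"
  obtains j where "j \<in> {1..\<nu>'}"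
    "\<And>y. y \<in> params_P G Z \<zeta> \<Longrightarrow> c \<bullet> \<sigma> y \<le> c \<bullet> \<sigma> (\<Omega> j *v \<zeta>)"
    "\<And>y. y \<in> params_P G Z \<zeta>0 \<Longrightarrow> c \<bullet> \<sigma> y \<le> c \<bullet> \<sigma> (\<Omega> j *v \<zeta>0)"
proof -
  have cone: "y \<in> matrix_cone G" if "y \<in> params_P G Z z" for y z
    using that by (simp add: params_P_def matrix_cone_def)
  define f where "f j = c \<bullet> \<sigma> (\<Omega> j *v (\<zeta> + \<zeta>0))" for j
  have "Max (f ` {1..\<nu>'}) \<in> f ` {1..\<nu>'}"
    using params_vertex_count_pos[OF params_vertices] by (intro Max_in) auto
  then obtain j where j: "j \<in> {1..\<nu>'}" "Max (f ` {1..\<nu>'}) = f j"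
    by blast
  have f_le: "f i \<le> f j" if "i \<in> {1..\<nu>'}" for i
    unfolding j(2)[symmetric] using that by (intro Max_ge) auto
  have sum_max: "c \<bullet> \<sigma> y + c \<bullet> \<sigma> y0 \<le> c \<bullet> \<sigma> (\<Omega> j *v \<zeta>) + c \<bullet> \<sigma> (\<Omega> j *v \<zeta>0)"
    if y: "y \<in> params_P G Z \<zeta>" and y0: "y0 \<in> params_P G Z \<zeta>0" for y y0
  proof -
    have "params_P G Z (\<zeta> + \<zeta>0) \<subseteq> {y. c \<bullet> \<sigma> y \<le> f j}"
      unfolding params_vertices[OF matrix_cone_add[OF \<zeta> \<zeta>0]]
      using f_le convex_weighted_facet_support_atMost[OF c] by (intro hull_minimal) (auto simp: f_def)
    with params_P_add[OF y y0] have "c \<bullet> \<sigma> (y + y0) \<le> f j" by blast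
    moreover have "c \<bullet> (\<sigma> y + \<sigma> y0) \<le> c \<bullet> \<sigma> (y + y0)"
      using facet_support_superadd[OF cone[OF y] cone[OF y0]] by (rule inner_mono_weight[OF c])
    moreover have "f j \<le> c \<bullet> (\<sigma> (\<Omega> j *v \<zeta>) + \<sigma> (\<Omega> j *v \<zeta>0))"
      unfolding f_def matrix_vector_right_distrib
      using facet_support_subadd by (rule inner_mono_weight[OF c])
    ultimately show ?thesis by (simp add: inner_add_right)
  qed
  have mem: "\<Omega> j *v \<zeta> \<in> params_P G Z \<zeta>" "\<Omega> j *v \<zeta>0 \<in> params_P G Z \<zeta>0"
    using j(1) by (simp_all add: params_vertices \<zeta> \<zeta>0 hull_inc)
  show thesis
    by (rule that[OF j(1)]) (use sum_max[OF _ mem(2)] sum_max[OF mem(1)] in force)+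
qed

text \<open>
  Only the extreme indices at the reference point \<open>\<zeta>0\<close> are used, although the vertices are taken
  at \<open>\<zeta>\<close>: for each positive weight, \<open>common_maximal_vertex\<close> supplies an index that is
  optimal at \<open>\<zeta>\<close> and extreme at \<open>\<zeta>0\<close>.
\<close>

lemma extreme_vertices_dominate:
  assumes \<zeta>: "\<zeta> \<in> matrix_cone H" and \<zeta>0: "\<zeta>0 \<in> matrix_cone H"
    and y: "y \<in> params_P G Z \<zeta>"
  defines "J \<equiv> extreme_index Y G Z \<Omega> \<nu>' \<zeta>0"
  obtains \<theta> where "\<And>j. j \<in> J \<Longrightarrow> 0 \<le> \<theta> j" "sum \<theta> J = 1"
    "poly_P Y y \<subseteq> poly_P Y (\<Sum>j\<in>J. \<theta> j *\<^sub>R (\<Omega> j *v \<zeta>))"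
proof -
  have cone: "y \<in> matrix_cone G" if "y \<in> params_P G Z \<zeta>" for y
    using that by (simp add: params_P_def matrix_cone_def)
  have "finite J" by (simp add: J_def extreme_index_def)
  moreover have "\<exists>j\<in>J. c \<bullet> \<sigma> y \<le> c \<bullet> \<sigma> (\<Omega> j *v \<zeta>)" if c: "\<forall>k. 0 < c $ k" for c
  proof -
    obtain j where j: "j \<in> {1..\<nu>'}"
      "\<And>y. y \<in> params_P G Z \<zeta> \<Longrightarrow> c \<bullet> \<sigma> y \<le> c \<bullet> \<sigma> (\<Omega> j *v \<zeta>)"
      "\<And>y. y \<in> params_P G Z \<zeta>0 \<Longrightarrow> c \<bullet> \<sigma> y \<le> c \<bullet> \<sigma> (\<Omega> j *v \<zeta>0)"
      using common_maximal_vertex[OF \<zeta> \<zeta>0 c] by metis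
    have "\<Omega> j *v \<zeta>0 \<in> params_P G Z \<zeta>0"
      using j(1) by (simp add: params_vertices \<zeta>0 hull_inc)
    from weight_maximal_imp_extreme[OF c this j(3)] j(1) have "j \<in> J"
      by (simp add: J_def extreme_index_def)
    with j(2)[OF y] show ?thesis by blast
  qed
  ultimately obtain \<theta> where \<theta>: "\<And>j. j \<in> J \<Longrightarrow> 0 \<le> \<theta> j" "sum \<theta> J = 1"
    and le: "\<sigma> y \<le> (\<Sum>j\<in>J. \<theta> j *\<^sub>R \<sigma> (\<Omega> j *v \<zeta>))"
    using convex_combination_above_if_no_weight_separates[of J "\<sigma> y" "\<lambda>j. \<sigma> (\<Omega> j *v \<zeta>)"] by blast
  have "\<sigma> (\<Omega> j *v \<zeta>) \<le> \<Omega> j *v \<zeta>" if "j \<in> J" for j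
    using that by (intro facet_support_le cone)
      (auto simp: J_def extreme_index_def params_vertices \<zeta> hull_inc)
  then have "(\<Sum>j\<in>J. \<theta> j *\<^sub>R \<sigma> (\<Omega> j *v \<zeta>)) \<le> (\<Sum>j\<in>J. \<theta> j *\<^sub>R (\<Omega> j *v \<zeta>))"
    using \<theta>(1) by (intro sum_mono) (simp add: less_eq_vec_def mult_left_mono)
  with le poly_P_le_facet_support[OF cone[OF y]]
  have "poly_P Y y \<subseteq> poly_P Y (\<Sum>j\<in>J. \<theta> j *\<^sub>R (\<Omega> j *v \<zeta>))"
    by (fastforce simp: poly_P_def intro: order_trans)
  with \<theta> show thesis by (rule that)
qed

end

end
section \<open>Feasible pairs admit an interpolating policy\<close>

theorem theorem3:
  fixes A :: "real^'n^'n" and B :: "real^'nu^'n" and C :: "real^'n^'nv"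
    and U :: "(real^'nu) set" and W :: "(real^'n) set" and V :: "(real^'nv) set"
    and Y :: "real^'n^'m" and G :: "real^'m^'g"
    and \<Lambda> :: "nat \<Rightarrow> real^'m^'n" and \<nu> :: nat
    and Z :: "real^'m^'l" and L :: "'l set" and vbar :: "real^'l"
    and H :: "real^'l^'h" and \<Omega> :: "nat \<Rightarrow> real^'l^'m" and \<nu>' :: nat
    and J :: "nat set" and \<zeta>0 :: "real^'l"
    and wbar :: "real^'m" and z z' :: "real^'l"
  assumes U_compact: "compact U" and W_polytope: "polytope W" and V_polytope: "polytope V"
    and configuration:
      "\<And>y. poly_P Y y = convex hull ((\<lambda>i. \<Lambda> i *v y) ` {1..\<nu>}) \<longleftrightarrow> y \<in> matrix_cone G"
    and measurement_template:
      "measurement_sets C V =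
         {X\<in>Kc. \<exists>y\<in>matrix_cone G. X \<subseteq> poly_P Y y \<and> block_le L (Z *v y) vbar}"
    and measurement_update:
      "\<And>z. ensemble_P Y G Z z \<inter> measurement_sets C V = ensemble_P Y G Z (block_min L vbar z)"
    and params_vertices:
      "\<And>\<zeta>. params_P G Z \<zeta> = convex hull ((\<lambda>j. \<Omega> j *v \<zeta>) ` {1..\<nu>'}) \<longleftrightarrow> \<zeta> \<in> matrix_cone H"
    and J_index: "\<zeta>0 \<in> matrix_cone H" "J = extreme_index Y G Z \<Omega> \<nu>' \<zeta>0"
    and W_eq: "W = poly_P Y wbar" and wbar: "wbar \<in> matrix_cone G"
    and U_convex: "convex U"
    and feasible: "(z, z') \<in> feasible_pairs A B U Y G \<Lambda> \<nu> wbar Z L vbar H \<Omega> J"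
  shows "\<exists>\<mu>\<in>policies U. ensemble_step A B C V W (ensemble_P Y G Z z) \<mu> \<subseteq> ensemble_P Y G Z z'"
proof -
  have conf: "poly_P Y y = convex hull ((\<lambda>i. \<Lambda> i *v y) ` {1..\<nu>})" if "y \<in> matrix_cone G" for y
    using that configuration by blast
  have vert: "params_P G Z \<zeta> = convex hull ((\<lambda>j. \<Omega> j *v \<zeta>) ` {1..\<nu>'})" if "\<zeta> \<in> matrix_cone H" for \<zeta>
    using that params_vertices by blast
  from feasible obtain \<zeta> \<xi> u where uU: "\<And>j. j \<in> J \<Longrightarrow> u j \<in> U"
    and \<zeta>1: "block_le L vbar \<zeta>" and \<zeta>2: "block_le (- L) z \<zeta>" and "H *v \<zeta> \<le> 0"
    and F: "\<And>i j. i \<in> {1..\<nu>} \<Longrightarrow> j \<in> J \<Longrightarrow>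
        (Y ** A ** \<Lambda> i ** \<Omega> j) *v \<zeta> + (Y ** B) *v u j + wbar \<le> \<xi> j \<and>
        G *v \<xi> j \<le> 0 \<and> Z *v \<xi> j \<le> z'"
    unfolding feasible_pairs_def by blast
  then have \<zeta>: "\<zeta> \<in> matrix_cone H" by (simp add: matrix_cone_def)
  have one: "1 \<in> {1..\<nu>}" using vertex_count_pos[OF conf] by simp
  have finJ: "finite J" by (simp add: J_index(2) extreme_index_def)
  define dominates where "dominates \<theta> X \<longleftrightarrow>
      (\<forall>j\<in>J. 0 \<le> \<theta> j) \<and> sum \<theta> J = 1 \<and> X \<subseteq> poly_P Y (\<Sum>j\<in>J. \<theta> j *\<^sub>R (\<Omega> j *v \<zeta>))"
    for \<theta> :: "nat \<Rightarrow> real" and X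
  have dom: "\<exists>\<theta>. dominates \<theta> X" if y: "y \<in> params_P G Z \<zeta>" and X: "X \<subseteq> poly_P Y y" for X y
  proof -
    obtain \<theta> where "\<And>j. j \<in> J \<Longrightarrow> 0 \<le> \<theta> j" "sum \<theta> J = 1"
      "poly_P Y y \<subseteq> poly_P Y (\<Sum>j\<in>J. \<theta> j *\<^sub>R (\<Omega> j *v \<zeta>))"
      using extreme_vertices_dominate[OF conf vert \<zeta> J_index(1) y, folded J_index(2)] by blast
    with X have "dominates \<theta> X"
      unfolding dominates_def by blast
    then show "\<exists>\<theta>. dominates \<theta> X" by blast
  qed
  have "J \<noteq> {}"
  proof -
    have "\<Omega> 1 *v \<zeta> \<in> params_P G Z \<zeta>"
      unfolding vert[OF \<zeta>] using params_vertex_count_pos[OF vert, of H] by (auto intro!: hull_inc)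
    then show ?thesis using dom[of _ "{}"] by (force simp: dominates_def)
  qed
  then obtain j0 where "j0 \<in> J" by blast
  \<comment> \<open>Sets that no convex combination of the extreme vertices dominates never arise as the meet
    of a member of the ensemble at \<open>z\<close> with a measurement set; their control is an arbitrary one from \<open>U\<close>.\<close>
  define \<theta> where "\<theta> X = (SOME t. dominates t X)" for X
  define \<mu> where "\<mu> X = (if \<exists>t. dominates t X then \<Sum>j\<in>J. \<theta> X j *\<^sub>R u j else u j0)" for X
  have \<theta>: "dominates (\<theta> X) X" if "\<exists>t. dominates t X" for X
    unfolding \<theta>_def using that by (rule someI_ex)
  have "\<mu> X \<in> U" for X
    using \<theta>[of X] uU \<open>j0 \<in> J\<close> finJ U_convex
    by (auto simp: \<mu>_def dominates_def intro!: convex_sum)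
  then have pol: "\<mu> \<in> policies U" by (simp add: policies_def)
  have "X' \<in> ensemble_P Y G Z z'"
    if X': "X' \<in> ensemble_step A B C V W (ensemble_P Y G Z z) \<mu>" for X'
  proof -
    from X' obtain X1 V1 where X1: "X1 \<in> ensemble_P Y G Z z" and V1: "V1 \<in> measurement_sets C V"
      and comp: "compact X'"
      and sub: "X' \<subseteq> {A *v x + B *v \<mu> (X1 \<inter> V1) + w | x w. x \<in> X1 \<inter> V1 \<and> w \<in> W}"
      unfolding ensemble_step_def meets_def Kc_def by blast
    define X where "X = X1 \<inter> V1"
    \<comment> \<open>Both collections are closed under compact subsets, so the meet lands in their intersection.\<close>
    have "compact X" using X1 V1
      by (auto simp: X_def ensemble_P_def measurement_sets_def Kc_def)
    then have "X \<in> ensemble_P Y G Z z \<inter> measurement_sets C V"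
      using X1 V1 unfolding ensemble_P_def measurement_sets_def Kc_def X_def by blast
    then obtain y where y: "G *v y \<le> 0" "Z *v y \<le> block_min L vbar z" "X \<subseteq> poly_P Y y"
      unfolding measurement_update by (auto simp: ensemble_P_def params_P_def)
    have "block_min L vbar z \<le> \<zeta>"
      using \<zeta>1 \<zeta>2 by (auto simp: block_min_def block_le_def less_eq_vec_def min.coboundedI2)
    then have "y \<in> params_P G Z \<zeta>" using y by (auto simp: params_P_def)
    from dom[OF this y(3)] have ex: "\<exists>t. dominates t X" .
    define t where "t = \<theta> X"
    have t0: "\<And>j. j \<in> J \<Longrightarrow> 0 \<le> t j" and t1: "sum t J = 1"
      and tX: "X \<subseteq> poly_P Y (\<Sum>j\<in>J. t j *\<^sub>R (\<Omega> j *v \<zeta>))"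
      using \<theta>[OF ex] by (auto simp: dominates_def t_def)
    have \<mu>X: "\<mu> X = (\<Sum>j\<in>J. t j *\<^sub>R u j)" using ex by (simp add: \<mu>_def t_def)
    define q where "q = (\<Sum>j\<in>J. t j *\<^sub>R (\<Omega> j *v \<zeta>))"
    define \<xi>' where "\<xi>' = (\<Sum>j\<in>J. t j *\<^sub>R \<xi> j)"
    have "q \<in> params_P G Z \<zeta>"
      unfolding vert[OF \<zeta>] q_def using finJ t0 t1
      by (intro convex_sum) (auto simp: J_index(2) extreme_index_def hull_inc)
    then have q: "q \<in> matrix_cone G" by (simp add: params_P_def matrix_cone_def)
    have step: "(Y ** A) *v (\<Lambda> i *v q) + (Y ** B) *v \<mu> X + wbar \<le> \<xi>'" if i: "i \<in> {1..\<nu>}" for i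
    proof -
      have "(Y ** A) *v (\<Lambda> i *v q) + (Y ** B) *v \<mu> X + wbar
          = (\<Sum>j\<in>J. t j *\<^sub>R ((Y ** A ** \<Lambda> i ** \<Omega> j) *v \<zeta> + (Y ** B) *v u j + wbar))"
        using t1 by (simp add: q_def \<mu>X scaleR_add_right sum.distrib scaleR_left.sum[symmetric]
            matrix_vector_mul_assoc[symmetric] matrix_vector_mult_scaleR
            linear_sum[OF matrix_vector_mul_linear])
      also have "\<dots> \<le> \<xi>'"
        unfolding \<xi>'_def using F[OF i] t0
        by (intro sum_mono) (auto simp: less_eq_vec_def intro!: mult_left_mono)
      finally show ?thesis .
    qed
    \<comment> \<open>The feasibility inequalities control the vertices of \<open>poly_P Y q\<close>; convexity extends them
      to all states in it.\<close>
    have "poly_P Y q \<subseteq> {x. (Y ** A) *v x \<le> \<xi>' - (Y ** B) *v \<mu> X - wbar}"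
      unfolding conf[OF q] using step
      by (intro hull_minimal convex_matrix_preimage_atMost) (auto simp: algebra_simps)
    with tX have state: "(Y ** A) *v x \<le> \<xi>' - (Y ** B) *v \<mu> X - wbar" if "x \<in> X" for x
      using that by (auto simp: q_def)
    have "X' \<subseteq> poly_P Y \<xi>'"
    proof
      fix x' assume "x' \<in> X'"
      with sub obtain x w where x: "x \<in> X" and w: "w \<in> W" and x': "x' = A *v x + B *v \<mu> X + w"
        by (auto simp: X_def)
      have "Y *v w \<le> wbar" using w by (simp add: W_eq poly_P_def)
      with add_mono[OF state[OF x] this]
      show "x' \<in> poly_P Y \<xi>'"
        by (simp add: poly_P_def x' matrix_vector_right_distrib matrix_vector_mul_assoc algebra_simps)
    qed
    moreover have "\<xi>' \<in> {y. G *v y \<le> 0} \<inter> {y. Z *v y \<le> z'}"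
      unfolding \<xi>'_def using finJ t0 t1 F[OF one]
      by (intro convex_sum convex_Int convex_matrix_preimage_atMost) auto
    ultimately show ?thesis
      using comp by (auto simp: ensemble_P_def params_P_def Kc_def)
  qed
  with pol show ?thesis by blast
qed

end
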